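(* (1) For all $n\geq 0$, $c_{7,3}(16n+5)\equiv 0\pmod 2$. (2) For $n\geq 0$, $c_{7,3}(16n+13)\equiv 0\pmod 2$ if and only if $n$ cannot be represented in the form $n=5k^2+4k$ for some integer $k$. (3) Let $p$ be a prime with $p\equiv 11$ or $19\pmod{20}$. For all integers $n,k\geq 0$ with $p\nmid n$, \[ c_{7,3}\left(8p^{2k+1}n+\frac{34p^{2k+2}+1}{5}\right)\equiv 0\pmod 2. \]
   Context: For complex $a,b$ the false theta function is $\Psi(a,b):=\sum_{n=0}^\infty a^{n(n+1)/2}b^{n(n-1)/2}-\sum_{n=-\infty}^{-1}a^{n(n+1)/2}b^{n(n-1)/2}$. For positive integers $r,s$, the integers $c_{r,s}(n)$ ($n\ge 0$) are defined by the power series identity $\sum_{n=0}^\infty c_{r,s}(n)q^n=\dfrac{1}{\Psi(-q^r,q^s)}$ (the denominator is a power series in $q$ with constant term $1$). *)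

theory Defs
  imports
    "HOL-Analysis.Infinite_Sum"
    "HOL-Computational_Algebra.Formal_Power_Series"
    "HOL-Number_Theory.Cong"
begin

text \<open>
  The two products \<open>n * (n + 1)\<close> and \<open>n * (n - 1)\<close> are even and nonnegative for every integer
  \<open>n\<close>, so \<open>div\<close> and \<open>nat\<close> lose nothing. The definition is polymorphic: at type \<^typ>\<open>complex\<close>
  it is the analytic false theta function, and at a type of formal power series the sums
  are taken in the \<open>X\<close>-adic topology.
\<close>

definition false_theta :: "'a \<Rightarrow> 'a \<Rightarrow> 'a::{comm_ring_1, t2_space}" where
  "false_theta a b =
     (\<Sum>\<^sub>\<infinity>n\<in>{0::int..}. a ^ nat (n * (n + 1) div 2) * b ^ nat (n * (n - 1) div 2))
   - (\<Sum>\<^sub>\<infinity>n\<in>{..-1::int}. a ^ nat (n * (n + 1) div 2) * b ^ nat (n * (n - 1) div 2))"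

definition false_theta_fps :: "nat \<Rightarrow> nat \<Rightarrow> int fps" where
  "false_theta_fps r s = false_theta (- (fps_X ^ r)) (fps_X ^ s)"

text \<open>
  For \<open>r, s > 0\<close> the reciprocal in \<open>\<int>[[q]]\<close> exists and is unique; see \<open>recip_coeff_fps\<close> and
  \<open>recip_coeff_unique\<close> below.
\<close>

definition recip_coeff :: "nat \<Rightarrow> nat \<Rightarrow> nat \<Rightarrow> int" where
  "recip_coeff r s n = fps_nth (THE C. C * false_theta_fps r s = 1) n"

lemma fps_has_sum_int:
  includes fps_syntax
  fixes f :: "int \<Rightarrow> 'a::comm_ring_1 fps"
  assumes "\<And>n i. n \<in> A \<Longrightarrow> f n $ i \<noteq> 0 \<Longrightarrow> \<bar>n\<bar> \<le> int i + 1"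
  shows "(f has_sum Abs_fps (\<lambda>i. \<Sum>n\<in>A \<inter> {-int i-1..int i+1}. f n $ i)) A"
  unfolding has_sum_def
proof (rule tendsto_fpsI)
  fix i
  let ?B = "A \<inter> {-int i-1..int i+1}"
  have "eventually (\<lambda>F. finite F \<and> ?B \<subseteq> F \<and> F \<subseteq> A) (finite_subsets_at_top A)"
    using eventually_finite_subsets_at_top by blast
  then show "eventually (\<lambda>F. sum f F $ i = Abs_fps (\<lambda>i. \<Sum>n\<in>A \<inter> {-int i-1..int i+1}. f n $ i) $ i)
     (finite_subsets_at_top A)"
  proof (rule eventually_mono)
    fix F assume F: "finite F \<and> ?B \<subseteq> F \<and> F \<subseteq> A"
    have "(\<Sum>n\<in>F. f n $ i) = (\<Sum>n\<in>?B. f n $ i)"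
    proof (rule sum.mono_neutral_right)
      show "\<forall>n\<in>F - ?B. f n $ i = 0"
      proof
        fix n assume n: "n \<in> F - ?B"
        then have "n \<in> A" using F by auto
        then show "f n $ i = 0" using assms[of n i] n by force
      qed
    qed (use F in auto)
    then show "sum f F $ i = Abs_fps (\<lambda>i. \<Sum>n\<in>A \<inter> {-int i-1..int i+1}. f n $ i) $ i"
      by (simp add: fps_sum_nth)
  qed
qed

lemma false_theta_term_nth:
  includes fps_syntax
  fixes r s :: nat
  shows "((- (fps_X ^ r)) ^ a * (fps_X ^ s) ^ b :: 'a::comm_ring_1 fps) $ i
     = (if i = r * a + s * b then (- 1) ^ a else 0)"
proof -
  have "(- (fps_X ^ r)) ^ a * (fps_X ^ s) ^ b = (fps_const ((- 1) ^ a) :: 'a fps) * fps_X ^ (r * a + s * b)"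
    by (simp add: power_minus[of "fps_X ^ r"] power_mult power_add mult.assoc
        flip: fps_const_power fps_const_neg)
  then show ?thesis by (auto simp: fps_X_power_nth)
qed

lemma abs_le_triangular_sum:
  fixes n :: int
  assumes "r > 0" "s > 0"
  shows "\<bar>n\<bar> \<le> int (r * nat (n * (n + 1) div 2) + s * nat (n * (n - 1) div 2))"
proof -
  let ?a = "n * (n + 1) div 2" and ?b = "n * (n - 1) div 2"
  have "even (n * (n + 1))" "even (n * (n - 1))" by auto
  then have e: "2 * ?a = n * (n + 1)" "2 * ?b = n * (n - 1)" by auto
  have nn: "?a \<ge> 0" "?b \<ge> 0"
    using e zero_le_mult_iff[of n "n + 1"] zero_le_mult_iff[of n "n - 1"] by linarith+
  have "2 * (?a + ?b) = 2 * n\<^sup>2"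
    using e by (simp add: algebra_simps power2_eq_square)
  then have "?a + ?b = n\<^sup>2" by (metis mult_cancel_left zero_neq_numeral)
  then have "?a + ?b = \<bar>n\<bar> * \<bar>n\<bar>" by (metis abs_mult_self_eq power2_eq_square)
  moreover have "\<bar>n\<bar> \<le> \<bar>n\<bar> * \<bar>n\<bar>"
    using mult_right_mono[of 1 "\<bar>n\<bar>" "\<bar>n\<bar>"] by (cases "n = 0") auto
  moreover have "?a \<le> int r * ?a" "?b \<le> int s * ?b"
    using mult_right_mono[of 1 "int r" ?a] mult_right_mono[of 1 "int s" ?b] assms nn by auto
  ultimately show ?thesis using nn by simp
qed

lemma false_theta_fps_nth:
  includes fps_syntax
  assumes "r > 0" "s > 0"
  shows "false_theta_fps r s $ i =
     (\<Sum>n = 0..int i + 1. if i = r * nat (n * (n + 1) div 2) + s * nat (n * (n - 1) div 2)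
        then (- 1) ^ nat (n * (n + 1) div 2) else 0)
   - (\<Sum>n = - int i - 1..-1. if i = r * nat (n * (n + 1) div 2) + s * nat (n * (n - 1) div 2)
        then (- 1) ^ nat (n * (n + 1) div 2) else 0)"
proof -
  let ?f = "\<lambda>n::int. (- (fps_X ^ r)) ^ nat (n * (n + 1) div 2) * (fps_X ^ s) ^ nat (n * (n - 1) div 2) :: int fps"
  have "\<bar>n\<bar> \<le> int i + 1" if "?f n $ i \<noteq> 0" for n i
    using that abs_le_triangular_sum[OF assms, of n]
    by (auto simp: false_theta_term_nth split: if_splits)
  then have "infsum ?f A = Abs_fps (\<lambda>i. \<Sum>n\<in>A \<inter> {-int i-1..int i+1}. ?f n $ i)" for A
    using fps_has_sum_int[of A ?f] infsumI by blast
  moreover have "{0..} \<inter> {-int i-1..int i+1} = {0..int i+1}"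
    "{..-1} \<inter> {-int i-1..int i+1} = {-int i-1..-1}" by auto
  ultimately show ?thesis
    unfolding false_theta_fps_def false_theta_def
    by (simp add: false_theta_term_nth)
qed

lemma false_theta_fps_nth_0:
  includes fps_syntax
  assumes "r > 0" "s > 0"
  shows "false_theta_fps r s $ 0 = 1"
proof -
  have "{0..1::int} = {0, 1}" "{-1..-1::int} = {-1}" by auto
  then show ?thesis using assms by (simp add: false_theta_fps_nth)
qed

lemma recip_coeff_unique:
  includes fps_syntax
  assumes "r > 0" "s > 0"
  shows "\<exists>!C. C * false_theta_fps r s = 1"
proof -
  let ?T = "false_theta_fps r s"
  have "fps_left_inverse ?T 1 * ?T = 1"
    using false_theta_fps_nth_0[OF assms] by (intro fps_left_inverse) simp
  moreover have "?T \<noteq> 0" using false_theta_fps_nth_0[OF assms] by auto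
  ultimately show ?thesis by (metis mult_cancel_right)
qed

lemma recip_coeff_fps:
  assumes "r > 0" "s > 0"
  shows "Abs_fps (recip_coeff r s) * false_theta_fps r s = 1"
proof -
  have "Abs_fps (recip_coeff r s) = (THE C. C * false_theta_fps r s = 1)"
    by (intro fps_ext) (simp add: recip_coeff_def)
  then show ?thesis using theI'[OF recip_coeff_unique[OF assms]] by simp
qed

end

theory Submission
  imports Defs "HOL-Library.Z2" "HOL-Number_Theory.Residues"
begin

text \<open>
  Modulo 2 the false theta function becomes \<open>F = \<Sum> q^(5k^2 + 2k)\<close>, summed over all integers \<open>k\<close>.
  Since \<open>F(q)^2 = F(q^2)\<close> modulo 2, the reciprocal \<open>C = 1/F\<close> satisfies
  \<open>C F(q^8) = F^7 = F(q) F(q^2) F(q^4)\<close>. The exponents of this triple product that are \<open>5\<close> or \<open>7\<close>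
  modulo 8 are the image of a linear change of summation variables, which again contains a factor
  \<open>F\<close>. Cancelling it and writing \<open>theta b = \<Sum> q^(5k^2 + bk)\<close> gives
  \<open>\<Sum> c(8n+5) q^n = q (theta 4)^2\<close> and \<open>\<Sum> c(8n+7) q^n = theta 1 * theta 4\<close>. The first
  identity yields (1) and (2). The coefficient of \<open>q^n\<close> in the second one counts representations
  of \<open>20n + 17\<close> as \<open>(10a+1)^2 + (10c+4)^2\<close>; in (3) this number has odd \<open>p\<close>-adic valuation for
  a prime \<open>p\<close> congruent to 3 modulo 4, so it is not a sum of two squares.
\<close>

unbundle fps_syntax

text \<open>These rules would turn sums and products in \<^typ>\<open>bit\<close> into bit operations.\<close>
declare add_bit_eq_xor [simp del] mult_bit_eq_and [simp del]

section \<open>Power series counting the values of an exponent function\<close>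

definition proper :: "('a \<Rightarrow> int) \<Rightarrow> bool" where
  "proper e \<longleftrightarrow> (\<forall>x. e x \<ge> 0) \<and> (\<forall>n. finite {x. e x = n})"

text \<open>The series \<Sum> q^(e x) over all x. As \<open>card\<close> of an infinite set is 0, it
  has this meaning only for exponents that are \<open>proper\<close>.\<close>

definition enum_fps :: "('a \<Rightarrow> int) \<Rightarrow> 'b::comm_semiring_1 fps" where
  "enum_fps e = Abs_fps (\<lambda>n. of_nat (card {x. e x = int n}))"

lemma enum_fps_nth: "enum_fps e $ n = of_nat (card {x. e x = int n})"
  by (simp add: enum_fps_def)

lemma fibre_add_eq:
  assumes "proper e" "proper f"
  shows "{(x, y). e x + f y = int n} = (\<Union>i\<in>{0..n}. {x. e x = int i} \<times> {y. f y = int (n - i)})"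
proof -
  have "\<exists>i\<le>n. e x = int i \<and> f y = int (n - i)" if "e x + f y = int n" for x y
  proof -
    have "e x \<ge> 0" "f y \<ge> 0" using assms by (auto simp: proper_def)
    with that show ?thesis by (intro exI[of _ "nat (e x)"]) auto
  qed
  then show ?thesis by fastforce
qed

lemma proper_add:
  assumes "proper e" "proper f"
  shows "proper (\<lambda>(x, y). e x + f y)"
proof -
  have nn: "e x + f y \<ge> 0" for x y using assms by (simp add: proper_def)
  have "finite {(x, y). e x + f y = n}" for n
  proof (cases "n \<ge> 0")
    case True
    then obtain m where "n = int m" by (metis nonneg_int_cases)
    then show ?thesis using assms by (simp add: fibre_add_eq[OF assms]) (auto simp: proper_def)
  next
    case False
    then have "{(x, y). e x + f y = n} = {}" using nn by force
    then show ?thesis by (metis finite.emptyI)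
  qed
  then show ?thesis using nn by (auto simp: proper_def case_prod_unfold)
qed

lemma proper_scale:
  assumes "proper e" "c > 0"
  shows "proper (\<lambda>x. c * e x)"
proof -
  have "finite {x. c * e x = n}" for n
    by (rule finite_subset[of _ "{x. e x = n div c}"]) (use assms in \<open>auto simp: proper_def\<close>)
  then show ?thesis using assms by (auto simp: proper_def)
qed

lemma enum_fps_mult:
  assumes "proper e" "proper f"
  shows "enum_fps e * enum_fps f = enum_fps (\<lambda>(x, y). e x + f y)"
proof (rule fps_ext)
  fix n
  have "{z. (case z of (x, y) \<Rightarrow> e x + f y) = int n} = {(x, y). e x + f y = int n}" by auto
  then have "card {z. (case z of (x, y) \<Rightarrow> e x + f y) = int n}
      = card (\<Union>i\<in>{0..n}. {x. e x = int i} \<times> {y. f y = int (n - i)})"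
    by (simp only: fibre_add_eq[OF assms])
  also have "\<dots> = (\<Sum>i=0..n. card ({x. e x = int i} \<times> {y. f y = int (n - i)}))"
    by (rule card_UN_disjoint) (use assms in \<open>auto simp: proper_def\<close>)
  finally show "(enum_fps e * enum_fps f) $ n = (enum_fps (\<lambda>(x, y). e x + f y) :: 'c fps) $ n"
    by (simp add: fps_mult_nth enum_fps_nth card_cartesian_product)
qed

lemma enum_fps_scale_nth:
  assumes "c > 0"
  shows "enum_fps (\<lambda>x. int c * e x) $ n = (if c dvd n then enum_fps e $ (n div c) else 0)"
proof (cases "c dvd n")
  case True
  then obtain m where "n = c * m" by blast
  then show ?thesis using assms by (simp add: enum_fps_nth)
next
  case False
  then have "int c * e x \<noteq> int n" for x by (metis dvd_triv_left int_dvd_int_iff)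
  then have "{x. int c * e x = int n} = {}" by blast
  then show ?thesis using False by (simp add: enum_fps_nth)
qed

section \<open>Squaring modulo 2\<close>

lemma fps_square_bit_nth:
  fixes f :: "bit fps"
  shows "(f * f) $ n = (if even n then f $ (n div 2) else 0)"
proof -
  let ?g = "\<lambda>i. f $ i * f $ (n - i)"
  \<comment> \<open>The reflection i -> n - i swaps the off-diagonal halves \<open>?L\<close> and
    \<open>?U\<close> of the Cauchy product, so they cancel in characteristic 2. Only the diagonal
    \<open>?M\<close> survives, where every element of \<open>bit\<close> is its own square.\<close>
  let ?L = "{i. 2 * i < n}" and ?U = "{i. i \<le> n \<and> n < 2 * i}" and ?M = "{i. 2 * i = n}"
  have fin: "finite ?L" "finite ?U" "finite ?M"
    by (rule finite_subset[of _ "{0..n}"]; auto)+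
  have "sum ?g ?U = sum ?g ?L"
    by (rule sum.reindex_bij_witness[of _ "\<lambda>i. n - i" "\<lambda>i. n - i"]) (auto simp: mult.commute)
  then have cancel: "sum ?g ?L + sum ?g ?U = 0" by simp
  have "{0..n} = (?L \<union> ?U) \<union> ?M" by auto
  then have "(f * f) $ n = sum ?g ((?L \<union> ?U) \<union> ?M)" by (simp only: fps_mult_nth)
  also have "\<dots> = sum ?g (?L \<union> ?U) + sum ?g ?M"
    by (rule sum.union_disjoint) (use fin in auto)
  also have "sum ?g (?L \<union> ?U) = sum ?g ?L + sum ?g ?U"
    by (rule sum.union_disjoint) (use fin in auto)
  finally have *: "(f * f) $ n = sum ?g ?M" using cancel by simp
  show ?thesis
  proof (cases "even n")
    case True
    then obtain m where m: "n = 2 * m" by blast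
    then have "?M = {m}" by auto
    then show ?thesis using * m by (cases "f $ m") auto
  next
    case False
    then have "?M = {}" by auto
    then show ?thesis using * False by (metis sum.empty)
  qed
qed

lemma enum_fps_square_bit: "(enum_fps e * enum_fps e :: bit fps) = enum_fps (\<lambda>x. 2 * e x)"
  by (rule fps_ext) (simp add: fps_square_bit_nth enum_fps_scale_nth[of 2 e, simplified])

section \<open>Dissection by exponents modulo 8\<close>

definition dissect :: "nat \<Rightarrow> 'a::comm_semiring_1 fps \<Rightarrow> 'a fps" where
  "dissect r f = Abs_fps (\<lambda>n. f $ (8 * n + r))"

text \<open>A factor in powers of q^8 preserves residue classes modulo 8, so it leaves the
  dissection as a series in q.\<close>

lemma dissect_mult_enum:
  assumes "r < 8"
  shows "dissect r (f * enum_fps (\<lambda>x. 8 * e x)) = dissect r f * enum_fps e"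
proof (rule fps_ext)
  fix n
  let ?g = "enum_fps (\<lambda>x. 8 * e x)"
  have g: "?g $ m = (if 8 dvd m then enum_fps e $ (m div 8) else 0)" for m
    using enum_fps_scale_nth[of 8 e m] by simp
  have "(?g * f) $ (8 * n + r) = (\<Sum>i=0..8*n+r. ?g $ i * f $ (8 * n + r - i))"
    by (simp add: fps_mult_nth)
  also have "\<dots> = (\<Sum>i\<in>(\<lambda>j. 8 * j) ` {0..n}. ?g $ i * f $ (8 * n + r - i))"
  proof (rule sum.mono_neutral_right)
    show "\<forall>i\<in>{0..8 * n + r} - (\<lambda>j. 8 * j) ` {0..n}. ?g $ i * f $ (8 * n + r - i) = 0"
    proof
      fix i assume i: "i \<in> {0..8 * n + r} - (\<lambda>j. 8 * j) ` {0..n}"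
      have "\<not> 8 dvd i"
      proof
        assume "8 dvd i"
        then obtain j where j: "i = 8 * j" by blast
        \<comment> \<open>As \<open>r < 8\<close>, the bound 8j \<le> 8n + r forces j \<le>
          n.\<close>
        with i assms have "j \<in> {0..n}" by simp
        with i j show False by blast
      qed
      then show "?g $ i * f $ (8 * n + r - i) = 0" by (simp add: g)
    qed
  qed (use assms in auto)
  also have "\<dots> = (\<Sum>j=0..n. enum_fps e $ j * f $ (8 * (n - j) + r))"
    by (subst sum.reindex) (auto simp: inj_on_def g diff_mult_distrib2 intro!: sum.cong)
  finally show "dissect r (f * ?g) $ n = (dissect r f * enum_fps e) $ n"
    by (simp add: dissect_def fps_mult_nth mult.commute[of f] mult.commute[of _ "enum_fps e"])
qed

text \<open>The map \<open>h\<close> parametrizes exactly the indices with exponent in class r, so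
  it matches the fibres of \<open>e'\<close> with those of \<open>e\<close>. Dissection thus becomes
  a change of summation variables.\<close>

lemma dissect_enum:
  assumes "inj h" "\<And>y. e (h y) = 8 * e' y + int r" "\<And>x. e x mod 8 = int r \<Longrightarrow> x \<in> range h" "r < 8"
  shows "dissect r (enum_fps e) = enum_fps e'"
proof (rule fps_ext)
  fix n
  have "{x. e x = int (8 * n + r)} = h ` {y. e' y = int n}"
  proof (intro equalityI subsetI)
    fix x assume "x \<in> {x. e x = int (8 * n + r)}"
    then have x: "e x = 8 * int n + int r" by simp
    then have "e x mod 8 = int r" using assms(4) by simp
    then obtain y where "x = h y" using assms(3) by blast
    then show "x \<in> h ` {y. e' y = int n}" using x assms(2)[of y] by simp
  qed (use assms(2) in auto)
  then have "card {x. e x = int (8 * n + r)} = card {y. e' y = int n}"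
    using assms(1) by (simp add: card_image inj_on_subset)
  then show "dissect r (enum_fps e) $ n = (enum_fps e' :: 'c fps) $ n"
    by (simp add: dissect_def enum_fps_nth)
qed

section \<open>Theta series of the polynomials 5k^2 + bk\<close>

abbreviation (input) quad :: "int \<Rightarrow> int \<Rightarrow> int" where
  "quad b k \<equiv> 5 * k\<^sup>2 + b * k"

definition theta :: "int \<Rightarrow> bit fps" where
  "theta b = enum_fps (quad b)"

text \<open>From |bk| \<le> 4|k| and |k| \<le> k^2. The bound supplies nonnegative exponents, finite
  fibres and finite summation windows.\<close>

lemma abs_le_quad:
  assumes "\<bar>b\<bar> \<le> 4"
  shows "\<bar>k\<bar> \<le> quad b k"
proof -
  have "\<bar>b * k\<bar> \<le> 4 * \<bar>k\<bar>" using assms by (simp add: abs_mult mult_right_mono)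
  moreover have "\<bar>k\<bar> \<le> k\<^sup>2"
    using mult_right_mono[of 1 "\<bar>k\<bar>" "\<bar>k\<bar>"] by (cases "k = 0") (auto simp: power2_eq_square)
  ultimately show ?thesis by linarith
qed

lemma proper_quad:
  assumes "\<bar>b\<bar> \<le> 4"
  shows "proper (quad b)"
proof -
  have "finite {k. quad b k = n}" for n
  proof (rule finite_subset)
    have "k \<in> {-n..n}" if "quad b k = n" for k
      using abs_le_quad[OF assms, of k] that by auto
    then show "{k. quad b k = n} \<subseteq> {-n..n}" by blast
  qed simp
  moreover have "quad b k \<ge> 0" for k using abs_le_quad[OF assms, of k] by linarith
  ultimately show ?thesis by (simp add: proper_def)
qed

text \<open>The cofactor of k - l is 4 modulo 5, hence nonzero. So a coefficient of
  \<open>theta 4\<close> detects representability, not just its parity.\<close>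

lemma inj_quad_4: "inj (quad 4)"
proof (rule injI)
  fix k l :: int assume "quad 4 k = quad 4 l"
  then have "(k - l) * (5 * (k + l) + 4) = 0" by (simp add: algebra_simps power2_eq_square)
  moreover have "5 * (k + l) + 4 \<noteq> 0" by presburger
  ultimately show "k = l" by auto
qed

section \<open>Exponents of the triple product in classes 5 and 7 modulo 8\<close>

abbreviation weight :: "int \<times> int \<times> int \<Rightarrow> int" where
  "weight \<equiv> \<lambda>(n, m, l). quad 2 n + (2 * quad 2 m + 4 * quad 2 l)"

text \<open>The residue depends only on n mod 4 and the parities of m and l, which leaves sixteen
  cases to check.\<close>

lemma weight_mod_8:
  "weight (n, m, l) mod 8 = 5 \<longleftrightarrow> odd n \<and> odd m \<and> even ((n - 1) div 2 + l)"
  "weight (n, m, l) mod 8 = 7 \<longleftrightarrow> odd n \<and> even m \<and> even ((n - 1) div 2 + l)"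
proof -
  obtain i r where n: "n = 4 * i + r" "r \<in> {0, 1, 2, 3}"
    by (rule that[of "n div 4" "n mod 4"]) auto
  obtain j s where m: "m = 2 * j + s" "s \<in> {0, 1}"
    by (rule that[of "m div 2" "m mod 2"]) auto
  obtain k t where l: "l = 2 * k + t" "t \<in> {0, 1}"
    by (rule that[of "l div 2" "l mod 2"]) auto
  have "weight (n, m, l) = (5 * r\<^sup>2 + 2 * r + 10 * s\<^sup>2 + 4 * s + 20 * t\<^sup>2)
      + (10 * i\<^sup>2 + 5 * i * r + i + 5 * j\<^sup>2 + 5 * j * s + j + 10 * k\<^sup>2 + 10 * k * t + 2 * k + t) * 8"
    unfolding n m l by (simp add: algebra_simps power2_eq_square)
  then have w: "weight (n, m, l) mod 8 = (5 * r\<^sup>2 + 2 * r + 10 * s\<^sup>2 + 4 * s + 20 * t\<^sup>2) mod 8"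
    by (simp only: mod_mult_self1)
  have "n - 1 = 2 * (2 * i) + (r - 1)" using n(1) by simp
  then have "(n - 1) div 2 + l = (r - 1) div 2 + t + 2 * (i + k)"
    using l(1) by (simp only: div_mult_self4) simp
  then have parity: "even n \<longleftrightarrow> even r" "even m \<longleftrightarrow> even s"
    "even ((n - 1) div 2 + l) \<longleftrightarrow> even ((r - 1) div 2 + t)"
    using n(1) m(1) by simp_all
  show "weight (n, m, l) mod 8 = 5 \<longleftrightarrow> odd n \<and> odd m \<and> even ((n - 1) div 2 + l)"
    "weight (n, m, l) mod 8 = 7 \<longleftrightarrow> odd n \<and> even m \<and> even ((n - 1) div 2 + l)"
    unfolding w parity using n(2) m(2) l(2) by (elim insertE emptyE; simp)+
qed

text \<open>With n = 2u + 1 the second hypothesis makes u + l even, so b = (u - l)/2 and c = (u +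
  l)/2 are integers.\<close>

lemma linear_param_range:
  assumes "odd n" "even ((n - 1) div 2 + l)"
  obtains b c :: int where "n = 2 * (b + c) + 1" "l = c - b"
proof -
  obtain u where u: "n = 2 * u + 1" using assms(1) by (rule oddE)
  with assms(2) have "even (u + l)" by simp
  then obtain v where "u + l = 2 * v" by blast
  then show ?thesis using u by (intro that[of "u - v" v]) auto
qed

text \<open>
  Up to affine terms the substitution rests on \<open>2 (u^2 + v^2) = (u + v)^2 + (u - v)^2\<close>, applied
  to \<open>u = 5b + 1\<close> and \<open>v = 5c + 2\<close>.
\<close>

lemma dissect_weight_5:
  "dissect 5 (enum_fps weight)
   = enum_fps (\<lambda>(a, b, c). quad 4 a + (quad 2 b + quad 4 c) + 1)"
\<comment> \<open>The sign in m = -2a - 1 gives 2 \<open>quad 2 m\<close> = 8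
  \<open>quad 4 a\<close> + 6, while n and l contribute 8 (\<open>quad 2 b\<close> +
  \<open>quad 4 c\<close>) + 7. The constant 13 = 8 + 5 explains the summand 1.\<close>
proof (rule dissect_enum[where h = "\<lambda>(a, b, c). (2 * (b + c) + 1, - 2 * a - 1, c - b)"])
  fix x :: "int \<times> int \<times> int"
  assume w: "weight x mod 8 = int 5"
  obtain n m l where x: "x = (n, m, l)" by (metis prod_cases3)
  have *: "odd n" "odd m" "even ((n - 1) div 2 + l)"
    using w weight_mod_8(1)[of n m l] unfolding x by simp_all
  obtain b c where "n = 2 * (b + c) + 1" "l = c - b" using linear_param_range[OF *(1,3)] .
  moreover obtain a where "m = 2 * a + 1" using *(2) by (rule oddE)
  ultimately have "x = (\<lambda>(a, b, c). (2 * (b + c) + 1, - 2 * a - 1, c - b)) (- a - 1, b, c)"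
    by (simp add: x)
  then show "x \<in> range (\<lambda>(a, b, c). (2 * (b + c) + 1, - 2 * a - 1, c - b))" by (rule range_eqI)
qed (auto simp: inj_def algebra_simps power2_eq_square)

text \<open>The variables b and c are as in class 5. Now m = 2a gives 2 \<open>quad 2 m\<close> = 8
  \<open>quad 1 a\<close>; the residue 7 comes from n and l alone, without a shift.\<close>

lemma dissect_weight_7:
  "dissect 7 (enum_fps weight) = enum_fps (\<lambda>(a, b, c). quad 1 a + (quad 2 b + quad 4 c))"
proof (rule dissect_enum[where h = "\<lambda>(a, b, c). (2 * (b + c) + 1, 2 * a, c - b)"])
  fix x :: "int \<times> int \<times> int"
  assume w: "weight x mod 8 = int 7"
  obtain n m l where x: "x = (n, m, l)" by (metis prod_cases3)
  have *: "odd n" "even m" "even ((n - 1) div 2 + l)"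
    using w weight_mod_8(2)[of n m l] unfolding x by simp_all
  obtain b c where "n = 2 * (b + c) + 1" "l = c - b" using linear_param_range[OF *(1,3)] .
  moreover obtain a where "m = 2 * a" using *(2) by blast
  ultimately have "x = (\<lambda>(a, b, c). (2 * (b + c) + 1, 2 * a, c - b)) (a, b, c)"
    by (simp add: x)
  then show "x \<in> range (\<lambda>(a, b, c). (2 * (b + c) + 1, 2 * a, c - b))" by (rule range_eqI)
qed (auto simp: inj_def algebra_simps power2_eq_square)

lemma theta_triple:
  assumes "\<bar>a\<bar> \<le> 4" "\<bar>b\<bar> \<le> 4" "\<bar>c\<bar> \<le> 4"
  shows "theta a * (theta b * theta c) = enum_fps (\<lambda>(x, y, z). quad a x + (quad b y + quad c z))"
proof -
  have "theta b * theta c = enum_fps (\<lambda>(y, z). quad b y + quad c z)"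
    unfolding theta_def by (intro enum_fps_mult proper_quad assms)
  then show ?thesis
    unfolding theta_def
    by (simp only:, subst enum_fps_mult[OF proper_quad proper_add[OF proper_quad proper_quad]])
      (simp_all add: assms case_prod_unfold)
qed

lemma enum_fps_shift:
  assumes "\<And>x. e x \<ge> 0"
  shows "enum_fps (\<lambda>x. e x + 1) = fps_X * enum_fps e"
proof (rule fps_ext)
  fix n
  show "enum_fps (\<lambda>x. e x + 1) $ n = (fps_X * enum_fps e :: 'b fps) $ n"
  proof (cases n)
    case 0
    have "e x + 1 \<noteq> 0" for x using assms[of x] by linarith
    then show ?thesis using 0 by (simp add: enum_fps_nth)
  next
    case (Suc m)
    have "e x + 1 = int n \<longleftrightarrow> e x = int m" for x using Suc by auto
    then show ?thesis using Suc by (simp add: enum_fps_nth)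
  qed
qed

section \<open>Dissecting the reciprocal of the theta series\<close>

lemma theta_2_power_7: "theta 2 ^ 7 = enum_fps weight"
  and theta_2_power_8: "theta 2 ^ 8 = enum_fps (\<lambda>x. 8 * quad 2 x)"
proof -
  let ?F = "theta 2"
  have F2: "?F ^ 2 = enum_fps (\<lambda>x. 2 * quad 2 x)"
    by (simp only: theta_def power2_eq_square enum_fps_square_bit)
  have "?F ^ 4 = ?F ^ 2 * ?F ^ 2" by (simp flip: power_add)
  then have F4: "?F ^ 4 = enum_fps (\<lambda>x. 4 * quad 2 x)"
    by (simp only: F2 enum_fps_square_bit) simp
  have "?F ^ 8 = ?F ^ 4 * ?F ^ 4" by (simp flip: power_add)
  then show "?F ^ 8 = enum_fps (\<lambda>x. 8 * quad 2 x)"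
    by (simp only: F4 enum_fps_square_bit) simp
  have p: "proper (\<lambda>x. 2 * quad 2 x)" "proper (\<lambda>x. 4 * quad 2 x)" "proper (quad 2)"
    by (intro proper_scale proper_quad; simp)+
  have "?F ^ 7 = ?F * (?F ^ 2 * ?F ^ 4)" by (simp flip: power_add power_Suc)
  then have "?F ^ 7 = enum_fps (quad 2) * enum_fps (\<lambda>(x, y). 2 * quad 2 x + 4 * quad 2 y)"
    by (simp only: F2 F4 enum_fps_mult[OF p(1,2)]) (simp only: theta_def)
  also have "\<dots> = enum_fps weight"
    by (subst enum_fps_mult[OF p(3) proper_add[OF p(1,2)]]) (simp add: case_prod_unfold)
  finally show "?F ^ 7 = enum_fps weight" .
qed

text \<open>Permits cancelling \<open>theta 2\<close>. Its constant term is 1, since only k = 0 has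
  exponent 0.\<close>

lemma theta_2_neq_0: "theta 2 \<noteq> 0"
proof
  assume "theta 2 = 0"
  then have "theta 2 $ 0 = 0" by simp
  moreover have "quad 2 k = 0 \<longleftrightarrow> k = 0" for k using abs_le_quad[of 2 k] by auto
  then have "{k. quad 2 k = 0} = {0}" by simp
  ultimately show False by (simp add: theta_def enum_fps_nth)
qed

lemma dissect_theta_recip:
  assumes "C * theta 2 = 1"
  shows "dissect 5 C = fps_X * (theta 4 * theta 4)" "dissect 7 C = theta 1 * theta 4"
proof -
  have "C * theta 2 ^ 8 = C * theta 2 * theta 2 ^ 7" by (simp add: mult.assoc flip: power_Suc)
  then have C: "C * enum_fps (\<lambda>x. 8 * quad 2 x) = enum_fps weight"
    using assms by (simp only: theta_2_power_7 theta_2_power_8) simp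
  have nn: "quad b x \<ge> 0" if "\<bar>b\<bar> \<le> 4" for b x using abs_le_quad[OF that, of x] by linarith
  \<comment> \<open>The eighth power is a series in q^8, so dissecting its product with C turns it
    back into \<open>theta 2\<close>.\<close>
  have "dissect 5 C * theta 2 = dissect 5 (enum_fps weight)"
    unfolding C[symmetric] theta_def by (rule dissect_mult_enum[symmetric]) simp
  also have "\<dots> = enum_fps (\<lambda>x. (case x of (a, b, c) \<Rightarrow> quad 4 a + (quad 2 b + quad 4 c)) + 1)"
    unfolding dissect_weight_5 by (simp add: case_prod_unfold)
  also have "\<dots> = fps_X * (theta 4 * (theta 2 * theta 4))"
    by (subst enum_fps_shift) (auto simp: theta_triple intro!: add_nonneg_nonneg nn)
  finally have "dissect 5 C * theta 2 = fps_X * (theta 4 * theta 4) * theta 2"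
    by (simp only: mult_ac)
  then show "dissect 5 C = fps_X * (theta 4 * theta 4)" using theta_2_neq_0 by simp
  have "dissect 7 C * theta 2 = dissect 7 (enum_fps weight)"
    unfolding C[symmetric] theta_def by (rule dissect_mult_enum[symmetric]) simp
  also have "\<dots> = theta 1 * (theta 2 * theta 4)"
    unfolding dissect_weight_7 by (simp add: theta_triple)
  finally have "dissect 7 C * theta 2 = theta 1 * theta 4 * theta 2"
    by (simp only: mult_ac)
  then show "dissect 7 C = theta 1 * theta 4" using theta_2_neq_0 by simp
qed

section \<open>Reduction of the false theta function modulo 2\<close>

definition fps_mod2 :: "int fps \<Rightarrow> bit fps" where
  "fps_mod2 f = Abs_fps (\<lambda>n. of_int (f $ n))"

lemma fps_mod2_mult: "fps_mod2 (f * g) = fps_mod2 f * fps_mod2 g"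
  by (rule fps_ext) (simp add: fps_mod2_def fps_mult_nth)

lemma fps_mod2_1: "fps_mod2 1 = 1"
  by (rule fps_ext) (simp add: fps_mod2_def)

lemma of_int_bit_eq_0_iff: "(of_int x :: bit) = 0 \<longleftrightarrow> even x"
  by (cases "even x") (auto elim!: evenE oddE)

text \<open>The exponent is 7n(n+1)/2 + 3n(n-1)/2 = 5n^2 + 2n. Modulo 2 both the signs of the terms
  and the minus before the negative half vanish, so the halves join into one sum over all
  integers.\<close>

lemma fps_mod2_false_theta: "fps_mod2 (false_theta_fps 7 3) = theta 2"
proof (rule fps_ext)
  fix i
  let ?e = "\<lambda>n::int. 7 * nat (n * (n + 1) div 2) + 3 * nat (n * (n - 1) div 2)"
  have e: "int (?e n) = quad 2 n" for n
  proof -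
    have "even (n * (n + 1))" "even (n * (n - 1))" by auto
    then obtain a b where ab: "n * (n + 1) = 2 * a" "n * (n - 1) = 2 * b" by (meson dvdE)
    have "a \<ge> 0" "b \<ge> 0"
      using ab zero_le_mult_iff[of n "n + 1"] zero_le_mult_iff[of n "n - 1"] by linarith+
    then have "2 * int (?e n) = 7 * (2 * a) + 3 * (2 * b)" unfolding ab by simp
    also have "\<dots> = 2 * quad 2 n"
      unfolding ab[symmetric] by (simp add: algebra_simps power2_eq_square)
    finally show ?thesis by simp
  qed
  have eq: "i = ?e n \<longleftrightarrow> quad 2 n = int i" for n
    unfolding e[symmetric] of_nat_eq_iff by (rule eq_commute)
  let ?g = "\<lambda>n. if quad 2 n = int i then 1 else 0 :: bit"
  have "fps_mod2 (false_theta_fps 7 3) $ i = sum ?g {0..int i + 1} + sum ?g {- int i - 1..-1}"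
  proof -
    have diff: "x - y = x + y" for x y :: bit by (cases x; cases y) simp_all
    have "of_int (if i = ?e n then (- 1) ^ m else 0) = ?g n" for n m
      unfolding eq by simp
    then show ?thesis
      by (simp only: fps_mod2_def fps_nth_Abs_fps false_theta_fps_nth zero_less_numeral
          of_int_diff of_int_sum diff)
  qed
  also have "\<dots> = sum ?g ({0..int i + 1} \<union> {- int i - 1..-1})"
    by (rule sum.union_disjoint[symmetric]) auto
  \<comment> \<open>The window loses nothing, because |n| \<le> \<open>quad 2 n\<close> = i.\<close>
  also have "\<dots> = sum ?g {n. quad 2 n = int i}"
  proof (rule sum.mono_neutral_right)
    show "{n. quad 2 n = int i} \<subseteq> {0..int i + 1} \<union> {- int i - 1..-1}"
    proof
      fix n assume "n \<in> {n. quad 2 n = int i}"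
      then show "n \<in> {0..int i + 1} \<union> {- int i - 1..-1}"
        using abs_le_quad[of 2 n] by auto
    qed
  qed auto
  also have "\<dots> = theta 2 $ i" by (simp add: theta_def enum_fps_nth)
  finally show "fps_mod2 (false_theta_fps 7 3) $ i = theta 2 $ i" .
qed

lemma recip_coeff_mod2_dissect:
  "(of_int (recip_coeff 7 3 (8 * n + 5)) :: bit) = (fps_X * (theta 4 * theta 4)) $ n"
  "(of_int (recip_coeff 7 3 (8 * n + 7)) :: bit) = (theta 1 * theta 4) $ n"
proof -
  let ?C = "fps_mod2 (Abs_fps (recip_coeff 7 3))"
  have "?C * theta 2 = 1"
    using recip_coeff_fps[of 7 3]
    by (simp flip: fps_mod2_mult fps_mod2_false_theta add: fps_mod2_1)
  note D = dissect_theta_recip[OF this]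
  have "(of_int (recip_coeff 7 3 (8 * n + r)) :: bit) = dissect r ?C $ n" for r
    by (simp add: dissect_def fps_mod2_def)
  then show "(of_int (recip_coeff 7 3 (8 * n + 5)) :: bit) = (fps_X * (theta 4 * theta 4)) $ n"
    "(of_int (recip_coeff 7 3 (8 * n + 7)) :: bit) = (theta 1 * theta 4) $ n"
    by (simp_all only: D)
qed

section \<open>Classes 5 and 13 modulo 16\<close>

lemma even_recip_coeff_16_5: "even (recip_coeff 7 3 (16 * n + 5))"
proof -
  \<comment> \<open>The index 16n + 5 = 8(2n) + 5 picks an even power of q, but q times a square
    modulo 2 has only odd powers.\<close>
  have "(fps_X * (theta 4 * theta 4)) $ (2 * n) = 0"
    by (cases n) (simp_all add: fps_square_bit_nth)
  then show ?thesis
    using recip_coeff_mod2_dissect(1)[of "2 * n"] by (simp add: of_int_bit_eq_0_iff)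
qed

text \<open>Here 16n + 13 = 8(2n + 1) + 5 picks coefficient 2n of the square of
  \<open>theta 4\<close>, which is coefficient n of \<open>theta 4\<close>. By injectivity it counts
  at most one k.\<close>

lemma odd_recip_coeff_16_13:
  "odd (recip_coeff 7 3 (16 * n + 13)) \<longleftrightarrow> (\<exists>k. int n = quad 4 k)"
proof -
  have "(of_int (recip_coeff 7 3 (16 * n + 13)) :: bit) = theta 4 $ n"
    using recip_coeff_mod2_dissect(1)[of "2 * n + 1"]
    by (simp add: fps_square_bit_nth algebra_simps)
  also have "\<dots> = (if \<exists>k. int n = quad 4 k then 1 else 0)"
  proof (cases "\<exists>k. int n = quad 4 k")
    case True
    then obtain k where k: "int n = quad 4 k" by blast
    then have "{x. quad 4 x = int n} = {k}" using inj_quad_4 by (auto dest: injD)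
    then show ?thesis using True by (simp add: theta_def enum_fps_nth)
  next
    case False
    then have "{x. quad 4 x = int n} = {}" by (auto dest: sym)
    then have "theta 4 $ n = 0" by (simp add: theta_def enum_fps_nth)
    then show ?thesis using False by simp
  qed
  finally show ?thesis using of_int_bit_eq_0_iff by (metis zero_neq_one)
qed

section \<open>Sums of two squares and primes congruent to 3 modulo 4\<close>

lemma prime_3_mod_4_dvd_sum_squares:
  fixes x y :: int
  assumes p: "prime p" "p mod 4 = 3" and dvd: "int p dvd x\<^sup>2 + y\<^sup>2"
  shows "int p dvd x"
proof (rule ccontr)
  assume x: "\<not> int p dvd x"
  define h where "h = (p - 1) div 2"
  have h: "p - 1 = 2 * h" "odd h" using p(2) unfolding h_def by presburger+
  have pp: "prime (int p)" using p(1) by simp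
  have y: "\<not> int p dvd y"
  proof
    assume "int p dvd y"
    then have "int p dvd y\<^sup>2" by (simp add: power2_eq_square)
    then have "int p dvd x\<^sup>2" using dvd by (simp only: dvd_add_left_iff)
    then show False using x prime_dvd_power[OF pp] by blast
  qed
  have fermat: "[z ^ (p - 1) = 1] (mod int p)" if z: "\<not> int p dvd z" for z
  proof -
    \<comment> \<open>Fermat's theorem is applied to |z|; the even exponent p - 1 removes the
      absolute value.\<close>
    have "[nat \<bar>z\<bar> ^ (p - 1) = 1] (mod p)"
      using p(1) z by (intro fermat_theorem) (simp_all flip: int_dvd_int_iff)
    then have "[\<bar>z\<bar> ^ (p - 1) = 1] (mod int p)" by (simp flip: cong_int_iff)
    moreover have "\<bar>z\<bar> ^ (p - 1) = z ^ (p - 1)" using h by (simp add: power_even_abs)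
    ultimately show ?thesis by simp
  qed
  \<comment> \<open>Raised to the odd power h = (p - 1)/2, this congruence becomes x^(p-1) =
    -y^(p-1), and Fermat turns it into 1 = -1 modulo p.\<close>
  have "[x\<^sup>2 = - (y\<^sup>2)] (mod int p)" using dvd by (simp add: cong_iff_dvd_diff)
  then have "[(x\<^sup>2) ^ h = (- (y\<^sup>2)) ^ h] (mod int p)" by (rule cong_pow)
  moreover have "(- (y\<^sup>2)) ^ h = - (y ^ (p - 1))" using h by (simp add: power_mult)
  moreover have "(x\<^sup>2) ^ h = x ^ (p - 1)" using h by (simp add: power_mult)
  ultimately have "[x ^ (p - 1) = - (y ^ (p - 1))] (mod int p)" by simp
  then have "[1 = - 1] (mod int p)"
    using fermat[OF x] fermat[OF y] by (meson cong_minus_minus_iff cong_sym cong_trans)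
  then have "int p dvd 2" by (simp add: cong_iff_dvd_diff)
  then have "p \<le> 2" by (auto dest: zdvd_imp_le)
  with p(2) prime_ge_2_nat[OF p(1)] show False by auto
qed

text \<open>By symmetry p divides both x and y, so a second factor p comes out and the cofactor is
  again a sum of two squares.\<close>

lemma prime_3_mod_4_sum_squares_descent:
  fixes x y m :: int
  assumes p: "prime p" "p mod 4 = 3" and eq: "x\<^sup>2 + y\<^sup>2 = int p * m"
  obtains u v where "m = int p * (u\<^sup>2 + v\<^sup>2)"
proof -
  have "int p dvd x\<^sup>2 + y\<^sup>2" "int p dvd y\<^sup>2 + x\<^sup>2" using eq by (simp_all add: add.commute[of "y\<^sup>2"])
  then have "int p dvd x" "int p dvd y"
    using prime_3_mod_4_dvd_sum_squares[OF p] by blast+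
  then obtain u v where "x = int p * u" "y = int p * v" by (meson dvdE)
  then have "int p * m = int p * (int p * (u\<^sup>2 + v\<^sup>2))"
    using eq by (simp add: algebra_simps power2_eq_square)
  then have "m = int p * (u\<^sup>2 + v\<^sup>2)" using prime_gt_0_nat[OF p(1)] by simp
  then show ?thesis by (rule that)
qed

text \<open>Each round of descent removes p^2. The single p left at the end must be paired with a
  factor p of m.\<close>

lemma sum_squares_odd_power:
  fixes x y m :: int
  assumes "prime p" "p mod 4 = 3" "x\<^sup>2 + y\<^sup>2 = int p ^ (2 * k + 1) * m"
  shows "int p dvd m"
  using assms(3)
proof (induction k arbitrary: x y)
  case (0 x y)
  then have "x\<^sup>2 + y\<^sup>2 = int p * m" by simp
  then obtain u v where "m = int p * (u\<^sup>2 + v\<^sup>2)"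
    by (rule prime_3_mod_4_sum_squares_descent[OF assms(1,2)])
  then show ?case by simp
next
  case (Suc k x y)
  then have "x\<^sup>2 + y\<^sup>2 = int p * (int p * (int p ^ (2 * k + 1) * m))" by (simp add: mult.assoc)
  then obtain u v where "int p * (int p ^ (2 * k + 1) * m) = int p * (u\<^sup>2 + v\<^sup>2)"
    by (rule prime_3_mod_4_sum_squares_descent[OF assms(1,2)])
  then have "u\<^sup>2 + v\<^sup>2 = int p ^ (2 * k + 1) * m" using prime_gt_0_nat[OF assms(1)] by simp
  then show ?case by (rule Suc.IH)
qed

section \<open>The family attached to a prime\<close>

lemma even_recip_coeff_prime:
  assumes p: "prime p" "[p = 11] (mod 20) \<or> [p = 19] (mod 20)" and n: "\<not> p dvd n"
  shows "even (recip_coeff 7 3 (8 * p ^ (2 * k + 1) * n + (34 * p ^ (2 * k + 2) + 1) div 5))"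
proof -
  have p20: "p mod 20 = 11 \<or> p mod 20 = 19" using p(2) by (simp add: cong_def)
  have p4: "p mod 4 = 3" using p20 by presburger
  \<comment> \<open>Modulo 40 the square of p depends only on p mod 20, and both 11^2 and 19^2 are
    1.\<close>
  define d r where "d = p div 20" and "r = p mod 20"
  then have "p = 20 * d + r" "r\<^sup>2 mod 40 = 1" using p20 by auto
  then have "p\<^sup>2 = r\<^sup>2 + 40 * (10 * d\<^sup>2 + d * r)"
    by (simp add: algebra_simps power2_eq_square)
  then have "p\<^sup>2 mod 40 = 1" using \<open>r\<^sup>2 mod 40 = 1\<close> by (simp only: mod_mult_self2)
  then have "(p\<^sup>2 mod 40) ^ (k + 1) mod 40 = 1" by simp
  then have "(p\<^sup>2) ^ (k + 1) mod 40 = 1" by (simp only: power_mod)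
  moreover have "(p\<^sup>2) ^ (k + 1) = p ^ (2 * k + 2)" by (simp only: power_mult[symmetric]) simp
  ultimately have "p ^ (2 * k + 2) mod 40 = 1" by simp
  then obtain t where t: "p ^ (2 * k + 2) = 40 * t + 1" by (metis mult_div_mod_eq)
  \<comment> \<open>Since 34(40t + 1) + 1 = 5(8 * 34t + 7), the index is 8M + 7.\<close>
  define M where "M = p ^ (2 * k + 1) * n + 34 * t"
  have M: "8 * p ^ (2 * k + 1) * n + (34 * p ^ (2 * k + 2) + 1) div 5 = 8 * M + 7"
  proof -
    have "34 * (40 * t + 1) + 1 = 5 * (272 * t + 7)" by simp
    then have "(34 * (40 * t + 1) + 1) div 5 = 272 * t + 7"
      by (metis nonzero_mult_div_cancel_left zero_neq_numeral)
    then show ?thesis unfolding t M_def by (simp add: algebra_simps)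
  qed
  \<comment> \<open>Multiplying by 20 and adding 17 = 1^2 + 4^2 completes both squares in
    \<open>quad 1 a + quad 4 c\<close>. The factorization exhibits an odd power of p.\<close>
  have M': "20 * M + 17 = p ^ (2 * k + 1) * (20 * n + 17 * p)"
  proof -
    have "20 * M + 17 = 20 * p ^ (2 * k + 1) * n + 17 * p ^ (2 * k + 2)"
      unfolding t M_def by (simp add: algebra_simps)
    then show ?thesis by (simp add: algebra_simps)
  qed
  have "quad 1 a + quad 4 c \<noteq> int M" for a c
  proof
    assume "quad 1 a + quad 4 c = int M"
    then have "(10 * a + 1)\<^sup>2 + (10 * c + 4)\<^sup>2 = int (20 * M + 17)"
      by (simp add: algebra_simps power2_eq_square)
    also have "\<dots> = int p ^ (2 * k + 1) * int (20 * n + 17 * p)" unfolding M' by simp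
    finally have "int p dvd int (20 * n + 17 * p)" by (rule sum_squares_odd_power[OF p(1) p4])
    then have "p dvd 20 * n + p * 17" by (simp only: int_dvd_int_iff mult.commute)
    then have "p dvd 20 * n" using dvd_add_left_iff[OF dvd_triv_left] by blast
    then have "p dvd 20" using n p(1) by (simp add: prime_dvd_mult_iff)
    \<comment> \<open>A prime this small would be 11 or 19 itself, and neither divides 20.\<close>
    then have "p \<le> 20" by (auto dest: dvd_imp_le)
    moreover have "p \<noteq> 20" using p20 by auto
    ultimately have "p mod 20 = p" by simp
    then show False using p20 \<open>p dvd 20\<close> by auto
  qed
  then have "{x. (case x of (a, c) \<Rightarrow> quad 1 a + quad 4 c) = int M} = {}" by auto
  moreover have "theta 1 * theta 4 = enum_fps (\<lambda>(a, c). quad 1 a + quad 4 c)"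
    unfolding theta_def by (intro enum_fps_mult proper_quad) simp_all
  ultimately have "(theta 1 * theta 4) $ M = 0"
    by (simp only: enum_fps_nth card.empty of_nat_0)
  then show ?thesis
    unfolding M using recip_coeff_mod2_dissect(2)[of M] by (simp add: of_int_bit_eq_0_iff)
qed

theorem theorem3p1:
  shows "(\<forall>n::nat. [recip_coeff 7 3 (16 * n + 5) = 0] (mod 2)) \<and>
    (\<forall>n::nat. [recip_coeff 7 3 (16 * n + 13) = 0] (mod 2) \<longleftrightarrow>
       \<not> (\<exists>k::int. int n = 5 * k ^ 2 + 4 * k)) \<and>
    (\<forall>p::nat. prime p \<and> ([p = 11] (mod 20) \<or> [p = 19] (mod 20)) \<longrightarrow>
       (\<forall>n k::nat. \<not> p dvd n \<longrightarrow>
          [recip_coeff 7 3 (8 * p ^ (2 * k + 1) * n + (34 * p ^ (2 * k + 2) + 1) div 5) = 0] (mod 2)))"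
  unfolding cong_0_iff
  using even_recip_coeff_16_5 odd_recip_coeff_16_13 even_recip_coeff_prime by blast

end
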